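(* Up to inner automorphism, the $1$-dimensional (solvable) subalgebras of $A_2$ are classified by the list $$J^1=\langle x_1+x_2\rangle,\quad J^2=\langle x_1\rangle,\quad J^3=\langle h_1+2h_2+x_1\rangle,\quad J^{4,\alpha}=\langle h_1+\alpha h_2\rangle\ (\alpha\in\mathbb{C}).$$ That is, every $1$-dimensional subalgebra of $A_2$ is equivalent to one of these, and the listed subalgebras are pairwise inequivalent, except that for $\alpha,\beta\in\mathbb{C}$, $J^{4,\alpha}\sim J^{4,\beta}$ if and only if $\alpha=1-\beta$, $\alpha=\beta$, $\alpha=(-1+\alpha)\beta$, $\alpha=-(-1+\alpha)(-1+\beta)$, $\alpha\beta=1$, or $-\alpha(-1+\beta)=1$. Equivalently, $J^{4,\alpha}\sim J^{4,\beta}$ if and only if $\beta$ is equal to one of those of the expressions $$\alpha,\quad \frac1\alpha,\quad 1-\alpha,\quad \frac{1}{1-\alpha},\quad \frac{\alpha}{-1+\alpha},\quad \frac{-1+\alpha}{\alpha}$$ that are defined.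
   Context: $A_2$ is the Lie algebra of traceless $3\times3$ complex matrices. Its Chevalley basis $x_i,y_i$ ($1\le i\le 3$), $h_1,h_2$ is defined by $$ah_1+bh_2+cx_1+dx_2+ex_3+c'y_1+d'y_2+e'y_3=\begin{pmatrix} a & c & -e\\ c' & b-a & d\\ -e' & d' & -b\end{pmatrix}.$$ $\langle W_1,\dots,W_m\rangle$ denotes the Lie subalgebra of $A_2$ generated by $W_1,\dots,W_m$. Two subalgebras are equivalent (written $\sim$) if an inner automorphism of $A_2$ maps one onto the other, i.e. if they are conjugate by an element of $\mathrm{SL}(3,\mathbb{C})$. *)

theory Defs
  imports "HOL-Analysis.Analysis"
begin

type_synonym mat3 = "complex^3^3"

(* The library has no complex scalar multiplication on complex^3^3 (only the real one);
   the interpretation provides the library notions mat.subspace, mat.span and mat.dim over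
   the complex numbers. *)
definition cscale :: "complex \<Rightarrow> mat3 \<Rightarrow> mat3" (infixr \<open>*\<^sub>m\<close> 75)
  where "c *\<^sub>m A = map_matrix (\<lambda>z. c * z) A"

global_interpretation mat: vector_space cscale
  by unfold_locales (simp_all add: cscale_def vec_eq_iff algebra_simps)

definition A2 :: "mat3 set"
  where "A2 = {A. trace A = 0}"

definition bracket :: "mat3 \<Rightarrow> mat3 \<Rightarrow> mat3"
  where "bracket A B = A ** B - B ** A"

definition A2_elem ::
  "complex \<Rightarrow> complex \<Rightarrow> complex \<Rightarrow> complex \<Rightarrow> complex \<Rightarrow> complex \<Rightarrow> complex \<Rightarrow> complex \<Rightarrow> mat3"
  where "A2_elem a b c d e c' d' e' =
    vector [vector [a, c, - e],
            vector [c', b - a, d],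
            vector [- e', d', - b]]"

definition h1 :: mat3 where "h1 = A2_elem 1 0 0 0 0 0 0 0"
definition h2 :: mat3 where "h2 = A2_elem 0 1 0 0 0 0 0 0"
definition x1 :: mat3 where "x1 = A2_elem 0 0 1 0 0 0 0 0"
definition x2 :: mat3 where "x2 = A2_elem 0 0 0 1 0 0 0 0"
definition x3 :: mat3 where "x3 = A2_elem 0 0 0 0 1 0 0 0"
definition y1 :: mat3 where "y1 = A2_elem 0 0 0 0 0 1 0 0"
definition y2 :: mat3 where "y2 = A2_elem 0 0 0 0 0 0 1 0"
definition y3 :: mat3 where "y3 = A2_elem 0 0 0 0 0 0 0 1"

lemma A2_elem_expand:
  "a *\<^sub>m h1 + b *\<^sub>m h2 + c *\<^sub>m x1 + d *\<^sub>m x2 + e *\<^sub>m x3 + c' *\<^sub>m y1 + d' *\<^sub>m y2 + e' *\<^sub>m y3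
    = A2_elem a b c d e c' d' e'"
  by (simp add: h1_def h2_def x1_def x2_def x3_def y1_def y2_def y3_def
      A2_elem_def cscale_def vec_eq_iff forall_3)

definition lie_subalgebra :: "mat3 set \<Rightarrow> bool"
  where "lie_subalgebra L \<longleftrightarrow>
    L \<subseteq> A2 \<and> mat.subspace L \<and> (\<forall>A\<in>L. \<forall>B\<in>L. bracket A B \<in> L)"

definition lie_generated :: "mat3 set \<Rightarrow> mat3 set"
  where "lie_generated S = lie_subalgebra hull S"

definition derived_algebra :: "mat3 set \<Rightarrow> mat3 set"
  where "derived_algebra L = mat.span {bracket A B | A B. A \<in> L \<and> B \<in> L}"

definition solvable_algebra :: "mat3 set \<Rightarrow> bool"
  where "solvable_algebra L \<longleftrightarrow> (\<exists>n. (derived_algebra ^^ n) L = {0})"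

definition inner_equiv :: "mat3 set \<Rightarrow> mat3 set \<Rightarrow> bool"  (infix \<open>\<sim>\<close> 50)
  where "L \<sim> M \<longleftrightarrow> (\<exists>P::mat3. det P = 1 \<and> (\<lambda>A. P ** A ** matrix_inv P) ` L = M)"

lemma inner_equiv_sym:
  assumes "L \<sim> M" shows "M \<sim> L"
proof -
  obtain P :: mat3 where P: "det P = 1" "(\<lambda>A. P ** A ** matrix_inv P) ` L = M"
    using assms by (auto simp: inner_equiv_def)
  let ?Q = "matrix_inv P"
  have "invertible P" using P(1) by (simp add: invertible_det_nz)
  then have inv: "P ** ?Q = mat 1 \<and> ?Q ** P = mat 1"
    unfolding invertible_def matrix_inv_def by (rule someI_ex)
  then have PQ: "P ** ?Q = mat 1" and QP: "?Q ** P = mat 1" by simp_all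
  have "?Q ** matrix_inv ?Q = mat 1 \<and> matrix_inv ?Q ** ?Q = mat 1"
    unfolding matrix_inv_def[of ?Q] by (rule someI[of _ P]) (simp add: PQ QP)
  then have "P ** (?Q ** matrix_inv ?Q) = P" by simp
  then have Q: "matrix_inv ?Q = P" by (simp add: matrix_mul_assoc PQ)
  have "det P * det ?Q = 1" using arg_cong[OF PQ, of det] by (simp add: det_mul)
  then have dQ: "det ?Q = 1" using P(1) by simp
  have "?Q ** (P ** A ** ?Q) ** P = A" for A :: mat3
  proof -
    have "?Q ** (P ** A ** ?Q) ** P = (?Q ** P) ** A ** (?Q ** P)"
      by (simp only: matrix_mul_assoc)
    then show ?thesis by (simp add: QP)
  qed
  then have "(\<lambda>A. ?Q ** A ** matrix_inv ?Q) ` M = L"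
    by (simp add: P(2)[symmetric] Q image_image)
  with dQ show ?thesis unfolding inner_equiv_def by blast
qed

definition J1 :: "mat3 set" where "J1 = lie_generated {x1 + x2}"
definition J2 :: "mat3 set" where "J2 = lie_generated {x1}"
definition J3 :: "mat3 set" where "J3 = lie_generated {h1 + 2 *\<^sub>m h2 + x1}"
definition J4 :: "complex \<Rightarrow> mat3 set" where "J4 \<alpha> = lie_generated {h1 + \<alpha> *\<^sub>m h2}"

end

theory Submission
  imports Defs "HOL-Computational_Algebra.Fundamental_Theorem_Algebra"
begin

text \<open>A 1-dimensional subalgebra is the span of a nonzero traceless matrix, and such spans are
  equivalent iff their generators are similar up to a nonzero scalar; the condition on the
  determinant of the conjugating matrix is immaterial since cube roots exist in the complex numbers.
  The Jordan normal forms of a nonzero traceless matrix, up to scaling, are those of the two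
  nilpotent types, the type with eigenvalues \<open>1, 1, - 2\<close> and one nontrivial block, and
  the diagonal ones. Two diagonal matrices are similar up to scaling iff their
  diagonals are proportional after one of the six permutations, which yields the
  six values of the parameter.\<close>

section \<open>Matrix arithmetic by named entries, scalar multiples and inverses\<close>

definition mat3_of :: "complex \<Rightarrow> complex \<Rightarrow> complex \<Rightarrow> complex \<Rightarrow> complex \<Rightarrow> complex
    \<Rightarrow> complex \<Rightarrow> complex \<Rightarrow> complex \<Rightarrow> mat3"
  where "mat3_of a b c d e f g h i = vector [vector [a, b, c], vector [d, e, f], vector [g, h, i]]"

lemma mat3_of_mult:
  "mat3_of a b c d e f g h i ** mat3_of a' b' c' d' e' f' g' h' i' =
    mat3_of (a*a' + b*d' + c*g') (a*b' + b*e' + c*h') (a*c' + b*f' + c*i')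
      (d*a' + e*d' + f*g') (d*b' + e*e' + f*h') (d*c' + e*f' + f*i')
      (g*a' + h*d' + i*g') (g*b' + h*e' + i*h') (g*c' + h*f' + i*i')"
  by (simp add: mat3_of_def matrix_matrix_mult_def sum_3 vec_eq_iff forall_3)

lemma cscale_mat3_of:
  "k *\<^sub>m mat3_of a b c d e f g h i =
    mat3_of (k*a) (k*b) (k*c) (k*d) (k*e) (k*f) (k*g) (k*h) (k*i)"
  by (simp add: mat3_of_def cscale_def vec_eq_iff forall_3)

lemma det_mat3_of:
  "det (mat3_of a b c d e f g h i) = a*e*i + b*f*g + c*d*h - a*f*h - b*d*i - c*e*g"
  by (simp add: mat3_of_def det_3)

lemma trace_mat3_of: "trace (mat3_of a b c d e f g h i) = a + e + i"
  by (simp add: mat3_of_def trace_def sum_3)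

lemma mat3_of_eq_iff:
  "mat3_of a b c d e f g h i = mat3_of a' b' c' d' e' f' g' h' i' \<longleftrightarrow>
    a = a' \<and> b = b' \<and> c = c' \<and> d = d' \<and> e = e' \<and> f = f' \<and> g = g' \<and> h = h' \<and> i = i'"
  by (auto simp: mat3_of_def vec_eq_iff forall_3)

lemma zero_mat3_of: "0 = mat3_of 0 0 0 0 0 0 0 0 0"
  by (simp add: mat3_of_def vec_eq_iff forall_3)

lemma mat3_of_cases:
  obtains a b c d e f g h i where "A = mat3_of a b c d e f g h i"
proof
  show "A = mat3_of (A$1$1) (A$1$2) (A$1$3) (A$2$1) (A$2$2) (A$2$3) (A$3$1) (A$3$2) (A$3$3)"
    by (simp add: mat3_of_def vec_eq_iff forall_3)
qed

lemma cscale_mult_left: "(c *\<^sub>m A) ** B = c *\<^sub>m (A ** B)"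
  by (simp add: cscale_def matrix_matrix_mult_def vec_eq_iff sum_distrib_left mult_ac)

lemma cscale_mult_right: "A ** (c *\<^sub>m B) = c *\<^sub>m (A ** B)"
  by (simp add: cscale_def matrix_matrix_mult_def vec_eq_iff sum_distrib_left mult_ac)

lemma trace_cscale: "trace (c *\<^sub>m A) = c * trace A"
  by (simp add: cscale_def trace_def sum_distrib_left)

lemma det_cscale: "det (c *\<^sub>m A) = c ^ 3 * det A"
  by (cases A rule: mat3_of_cases)
    (simp add: cscale_mat3_of det_mat3_of algebra_simps power3_eq_cube)

lemma matrix_inv_nonsingular:
  fixes P :: "'a::field^'n^'n"
  assumes "det P \<noteq> 0"
  shows "P ** matrix_inv P = mat 1" "matrix_inv P ** P = mat 1"
proof -
  have "invertible P" using assms by (simp add: invertible_det_nz)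
  then have "P ** matrix_inv P = mat 1 \<and> matrix_inv P ** P = mat 1"
    unfolding invertible_def matrix_inv_def by (rule someI_ex)
  then show "P ** matrix_inv P = mat 1" "matrix_inv P ** P = mat 1" by simp_all
qed

text \<open>The product of \<open>matrix_inv P\<close>, \<open>c *\<^sub>m P\<close> and
  \<open>matrix_inv (c *\<^sub>m P)\<close> is bracketed in two ways: one gives
  \<open>matrix_inv P\<close>, the other
  \<open>c *\<^sub>m matrix_inv (c *\<^sub>m P)\<close>.\<close>

lemma matrix_inv_cscale:
  assumes "det P \<noteq> 0" "c \<noteq> 0"
  shows "matrix_inv (c *\<^sub>m P) = (1 / c) *\<^sub>m matrix_inv P"
proof -
  have "det (c *\<^sub>m P) \<noteq> 0" using assms by (simp add: det_cscale)
  then have "(1 / c) *\<^sub>m (matrix_inv P ** ((c *\<^sub>m P) ** matrix_inv (c *\<^sub>m P))) =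
      (1 / c) *\<^sub>m matrix_inv P"
    by (simp add: matrix_inv_nonsingular)
  moreover have "(1 / c) *\<^sub>m (matrix_inv P ** ((c *\<^sub>m P) ** matrix_inv (c *\<^sub>m P))) =
      (1 / c) *\<^sub>m (c *\<^sub>m ((matrix_inv P ** P) ** matrix_inv (c *\<^sub>m P)))"
    by (simp only: cscale_mult_left cscale_mult_right matrix_mul_assoc)
  ultimately show ?thesis
    using assms by (simp add: matrix_inv_nonsingular)
qed

lemma nonsingular_mult_eq_0:
  fixes P :: mat3
  assumes "det P \<noteq> 0" "P ** A = 0"
  shows "A = 0"
proof -
  have "matrix_inv P ** (P ** A) = 0"
    using assms(2) by (simp add: matrix_matrix_mult_def vec_eq_iff)
  then show ?thesis
    by (simp add: matrix_mul_assoc matrix_inv_nonsingular[OF assms(1)])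
qed

section \<open>Similarity up to a nonzero scalar\<close>

text \<open>The intertwining form of \<open>P ** A ** matrix_inv P = k *\<^sub>m B\<close> contains
  no inverse, so for explicit matrices it amounts to nine scalar equations in the entries of
  \<open>P\<close>.\<close>

definition scaled_similar :: "mat3 \<Rightarrow> mat3 \<Rightarrow> bool"
  where "scaled_similar A B \<longleftrightarrow> (\<exists>P k. det P \<noteq> 0 \<and> k \<noteq> 0 \<and> P ** A = k *\<^sub>m (B ** P))"

lemma scaled_similarI:
  "det P \<noteq> 0 \<Longrightarrow> k \<noteq> 0 \<Longrightarrow> P ** A = k *\<^sub>m (B ** P) \<Longrightarrow> scaled_similar A B"
  unfolding scaled_similar_def by blast

lemma scaled_similar_trans:
  assumes "scaled_similar A B" "scaled_similar B C"
  shows "scaled_similar A C"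
proof -
  obtain P k Q l where P: "det P \<noteq> 0" "k \<noteq> 0" "P ** A = k *\<^sub>m (B ** P)"
    and Q: "det Q \<noteq> 0" "l \<noteq> 0" "Q ** B = l *\<^sub>m (C ** Q)"
    using assms unfolding scaled_similar_def by blast
  have "(Q ** P) ** A = Q ** (k *\<^sub>m (B ** P))"
    by (simp only: P(3) matrix_mul_assoc[symmetric])
  also have "\<dots> = k *\<^sub>m ((Q ** B) ** P)"
    by (simp only: cscale_mult_right matrix_mul_assoc)
  also have "\<dots> = (k * l) *\<^sub>m (C ** (Q ** P))"
    by (simp only: Q(3) cscale_mult_left mat.scale_scale matrix_mul_assoc)
  finally show ?thesis
    using P Q by (intro scaled_similarI[of "Q ** P" "k * l"]) (simp_all add: det_mul)
qed

text \<open>The columns of \<open>Q\<close> form a basis in which \<open>A\<close> acts by the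
  matrix \<open>B\<close>; the intertwiner is the inverse of \<open>Q\<close>, with scalar 1. Normal
  forms can thus be reached by exhibiting basis vectors.\<close>

lemma scaled_similarI_columns:
  assumes Q: "det Q \<noteq> 0" "A ** Q = Q ** B"
  shows "scaled_similar A B"
proof (rule scaled_similarI)
  have "det (matrix_inv Q) * det Q = 1"
    using Q(1) by (metis det_I det_mul matrix_inv_nonsingular(2))
  then show "det (matrix_inv Q) \<noteq> 0" by auto
  have "matrix_inv Q ** A = (matrix_inv Q ** (A ** Q)) ** matrix_inv Q"
    by (simp only: matrix_mul_assoc[symmetric] matrix_inv_nonsingular[OF Q(1)] matrix_mul_rid)
  also have "\<dots> = B ** matrix_inv Q"
    by (simp only: Q(2) matrix_mul_assoc matrix_inv_nonsingular[OF Q(1)] matrix_mul_lid)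
  finally show "matrix_inv Q ** A = 1 *\<^sub>m (B ** matrix_inv Q)" by simp
qed simp

text \<open>Serves twice: for cube roots, which normalize determinants, and for roots of
  characteristic polynomials.\<close>

lemma monic_cubic_root_exists:
  fixes p q r :: complex
  obtains x where "x ^ 3 + p * x\<^sup>2 + q * x + r = 0"
proof -
  have "\<not> constant (poly [:r, q, p, 1:])"
    by (simp add: constant_degree)
  then obtain x where "poly [:r, q, p, 1:] x = 0"
    using fundamental_theorem_of_algebra by blast
  then show thesis
    by (intro that[of x]) (simp add: algebra_simps power2_eq_square power3_eq_cube)
qed

text \<open>A conjugation carrying one line onto the other sends \<open>A\<close> to some
  \<open>k *\<^sub>m B\<close>, and \<open>k\<close> is nonzero because \<open>A\<close> is.
  Conversely, conjugation by a nonzero multiple of \<open>P\<close> agrees with conjugation by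
  \<open>P\<close>, so the determinant can be normalized to 1.\<close>

lemma inner_equiv_span_iff:
  assumes A: "A \<noteq> 0"
  shows "mat.span {A} \<sim> mat.span {B} \<longleftrightarrow> scaled_similar A B"
proof
  assume "mat.span {A} \<sim> mat.span {B}"
  then obtain P where P: "det P = 1"
    "(\<lambda>X. P ** X ** matrix_inv P) ` mat.span {A} = mat.span {B}"
    unfolding inner_equiv_def by blast
  from P(1) have inv: "P ** matrix_inv P = mat 1" "matrix_inv P ** P = mat 1"
    by (simp_all add: matrix_inv_nonsingular)
  have "P ** A ** matrix_inv P \<in> mat.span {B}"
    unfolding P(2)[symmetric] by (intro imageI mat.span_base) simp
  then obtain k where k: "P ** A ** matrix_inv P = k *\<^sub>m B"
    by (auto simp: mat.span_singleton)
  have PA: "P ** A = k *\<^sub>m (B ** P)"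
  proof -
    have "P ** A = (P ** A ** matrix_inv P) ** P"
      by (simp only: matrix_mul_assoc[symmetric] inv matrix_mul_rid)
    then show ?thesis by (simp only: k cscale_mult_left)
  qed
  have "k \<noteq> 0"
  proof
    assume "k = 0"
    with PA have "P ** A = 0" by simp
    with A P(1) show False using nonsingular_mult_eq_0[of P A] by simp
  qed
  with PA P(1) show "scaled_similar A B" by (intro scaled_similarI) auto
next
  assume "scaled_similar A B"
  then obtain P k where P: "det P \<noteq> 0" "k \<noteq> 0" "P ** A = k *\<^sub>m (B ** P)"
    unfolding scaled_similar_def by blast
  \<comment> \<open>Scaling a 3x3 matrix by \<open>c\<close> multiplies its determinant by
    \<open>c ^ 3\<close>.\<close>
  obtain c where c: "c ^ 3 = 1 / det P"
    using monic_cubic_root_exists[of 0 0 "- 1 / det P"] by auto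
  from c P(1) have "c \<noteq> 0" by auto
  have det: "det (c *\<^sub>m P) = 1" using c P(1) by (simp add: det_cscale)
  have conj: "(c *\<^sub>m P) ** (t *\<^sub>m A) ** matrix_inv (c *\<^sub>m P) = (t * k) *\<^sub>m B" for t
  proof -
    have "(c *\<^sub>m P) ** (t *\<^sub>m A) ** matrix_inv (c *\<^sub>m P) = t *\<^sub>m (P ** A ** matrix_inv P)"
      using \<open>c \<noteq> 0\<close> by (simp add: matrix_inv_cscale P(1) cscale_mult_left cscale_mult_right)
    also have "P ** A ** matrix_inv P = k *\<^sub>m B"
      by (simp add: P cscale_mult_left matrix_mul_assoc[symmetric] matrix_inv_nonsingular)
    finally show ?thesis by simp
  qed
  have "(\<lambda>X. (c *\<^sub>m P) ** X ** matrix_inv (c *\<^sub>m P)) ` mat.span {A} = mat.span {B}"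
  proof -
    have "s *\<^sub>m B \<in> range (\<lambda>t. (t * k) *\<^sub>m B)" for s
      using P(2) by (intro image_eqI[of _ _ "s / k"]) auto
    then show ?thesis
      by (auto simp: mat.span_singleton image_image conj)
  qed
  with det show "mat.span {A} \<sim> mat.span {B}" unfolding inner_equiv_def by blast
qed

section \<open>Lines as abelian subalgebras\<close>

lemma bracket_span_singleton:
  assumes "B \<in> mat.span {A}" "C \<in> mat.span {A}"
  shows "bracket B C = 0"
  using assms
  by (auto simp: mat.span_singleton bracket_def cscale_mult_left cscale_mult_right mult.commute)

lemma lie_subalgebra_span_singleton:
  assumes "trace A = 0"
  shows "lie_subalgebra (mat.span {A})"
proof -
  have "mat.span {A} \<subseteq> A2"
    using assms by (auto simp: A2_def mat.span_singleton trace_cscale)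
  then show ?thesis
    by (simp add: lie_subalgebra_def bracket_span_singleton mat.span_zero)
qed

text \<open>The bracket vanishes on a line, so the line is a subalgebra; every subalgebra containing
  \<open>A\<close> is a subspace and hence contains the line.\<close>

lemma lie_generated_singleton:
  assumes "trace A = 0"
  shows "lie_generated {A} = mat.span {A}"
  unfolding lie_generated_def
proof (rule hull_unique)
  show "{A} \<subseteq> mat.span {A}" by (rule mat.span_superset)
  show "lie_subalgebra (mat.span {A})" using assms by (rule lie_subalgebra_span_singleton)
  show "mat.span {A} \<subseteq> M" if "{A} \<subseteq> M" "lie_subalgebra M" for M
    using that by (simp add: lie_subalgebra_def mat.span_minimal)
qed

lemma dim_span_singleton: "A \<noteq> 0 \<Longrightarrow> mat.dim (mat.span {A}) = 1"
  using mat.dim_span_eq_card_independent[of "{A}"] by simp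

lemma dim_1_subspaceE:
  assumes "mat.subspace L" "mat.dim L = 1"
  obtains A where "A \<noteq> 0" "L = mat.span {A}"
proof -
  obtain S where S: "S \<subseteq> L" "mat.independent S" "L \<subseteq> mat.span S" "card S = mat.dim L"
    using mat.basis_exists[of L] by blast
  from S(4) assms(2) obtain A where "S = {A}" by (auto simp: card_1_singleton_iff)
  with S assms(1) have "A \<noteq> 0" "L = mat.span {A}"
    using mat.span_minimal[of "{A}" L] by auto
  then show thesis by (rule that)
qed

lemma solvable_algebra_span_singleton: "solvable_algebra (mat.span {A})"
proof -
  have "{bracket B C | B C. B \<in> mat.span {A} \<and> C \<in> mat.span {A}} = {0}"
    using bracket_span_singleton[of _ A] mat.span_zero[of "{A}"] by force
  then have "(derived_algebra ^^ 1) (mat.span {A}) = {0}"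
    by (simp add: derived_algebra_def)
  then show ?thesis unfolding solvable_algebra_def by blast
qed

section \<open>Explicit generators of the representatives\<close>

text \<open>The digits in \<open>nilp2\<close> and \<open>nilp1\<close> are the ranks.
  \<open>mixed\<close> has a Jordan block of size 2 for the eigenvalue 1 and the simple eigenvalue
  -2.\<close>

abbreviation nilp2 :: mat3 where "nilp2 \<equiv> mat3_of 0 1 0 0 0 1 0 0 0"
abbreviation nilp1 :: mat3 where "nilp1 \<equiv> mat3_of 0 1 0 0 0 0 0 0 0"
abbreviation mixed :: mat3 where "mixed \<equiv> mat3_of 1 1 0 0 1 0 0 0 (- 2)"
abbreviation diag3 :: "complex \<Rightarrow> complex \<Rightarrow> complex \<Rightarrow> mat3"
  where "diag3 a b c \<equiv> mat3_of a 0 0 0 b 0 0 0 c"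

lemma J_span:
  "J1 = mat.span {nilp2}" "J2 = mat.span {nilp1}" "J3 = mat.span {mixed}"
  "J4 \<alpha> = mat.span {diag3 1 (\<alpha> - 1) (- \<alpha>)}"
proof -
  have "x1 + x2 = nilp2" "x1 = nilp1" "h1 + 2 *\<^sub>m h2 + x1 = mixed"
    "h1 + \<alpha> *\<^sub>m h2 = diag3 1 (\<alpha> - 1) (- \<alpha>)"
    by (simp_all add: x1_def x2_def h1_def h2_def A2_elem_def cscale_def mat3_of_def
        vec_eq_iff forall_3)
  then have gen: "J1 = lie_generated {nilp2}" "J2 = lie_generated {nilp1}"
    "J3 = lie_generated {mixed}" "J4 \<alpha> = lie_generated {diag3 1 (\<alpha> - 1) (- \<alpha>)}"
    by (simp_all only: J1_def J2_def J3_def J4_def)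
  show "J1 = mat.span {nilp2}" "J2 = mat.span {nilp1}" "J3 = mat.span {mixed}"
    "J4 \<alpha> = mat.span {diag3 1 (\<alpha> - 1) (- \<alpha>)}"
    unfolding gen by (simp_all add: lie_generated_singleton trace_mat3_of)
qed

section \<open>Inequivalence\<close>

text \<open>With the entries of the intertwiner named, inequivalence means that the entry equations
  force its determinant to vanish.\<close>

lemma scaled_similarE:
  assumes "scaled_similar A B"
  obtains a b c d e f g h i k where "k \<noteq> 0"
    "a*e*i + b*f*g + c*d*h - a*f*h - b*d*i - c*e*g \<noteq> 0"
    "mat3_of a b c d e f g h i ** A = k *\<^sub>m (B ** mat3_of a b c d e f g h i)"
proof -
  obtain P k where P: "det P \<noteq> 0" "k \<noteq> 0" "P ** A = k *\<^sub>m (B ** P)"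
    using assms unfolding scaled_similar_def by blast
  obtain a b c d e f g h i where "P = mat3_of a b c d e f g h i"
    by (rule mat3_of_cases)
  with P that show thesis by (metis det_mat3_of)
qed

lemmas mat3_of_simps = mat3_of_mult cscale_mat3_of mat3_of_eq_iff

text \<open>The entry equations make the first column of the intertwiner zero.\<close>

lemma not_similar_nilp2_nilp1: "\<not> scaled_similar nilp2 nilp1"
  by (auto elim!: scaled_similarE simp: mat3_of_simps)

text \<open>The last two rows of an intertwiner satisfy the equation of a left eigenvector of a
  nilpotent matrix for the nonzero eigenvalues \<open>k\<close> and \<open>-2 * k\<close>, so they
  vanish. The same reason applies to \<open>nilp1\<close>.\<close>

lemma not_similar_nilp2_mixed: "\<not> scaled_similar nilp2 mixed"
  by (auto elim!: scaled_similarE simp: mat3_of_simps)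

lemma not_similar_nilp1_mixed: "\<not> scaled_similar nilp1 mixed"
  by (auto elim!: scaled_similarE simp: mat3_of_simps)

text \<open>The rows of an intertwiner into a diagonal matrix are left eigenvectors of the source.
  For the three matrices below, which are not diagonalizable, all of these have first entry 0.\<close>

lemma not_similar_diag:
  "\<not> scaled_similar nilp2 (diag3 x y z)" "\<not> scaled_similar nilp1 (diag3 x y z)"
  "\<not> scaled_similar mixed (diag3 x y z)"
proof -
  show "\<not> scaled_similar nilp2 (diag3 x y z)" "\<not> scaled_similar nilp1 (diag3 x y z)"
    by (auto elim!: scaled_similarE simp: mat3_of_simps)
  \<comment> \<open>Here \<open>p\<close> and \<open>q\<close> are the first two entries of a row
    and \<open>k * t\<close> is its eigenvalue. Multiplying the second equation by \<open>p\<close>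
    and inserting the first gives \<open>p * p = 0\<close>.\<close>
  have row: "p = 0" if "p = k * (t * p)" "p + q = k * (t * q)" for p q k t :: complex
  proof -
    from that have "p * p = 0" by algebra
    then show ?thesis by simp
  qed
  show "\<not> scaled_similar mixed (diag3 x y z)"
  proof
    assume "scaled_similar mixed (diag3 x y z)"
    then obtain a b c d e f g h i k where
      nz: "a*e*i + b*f*g + c*d*h - a*f*h - b*d*i - c*e*g \<noteq> 0"
      and eq: "mat3_of a b c d e f g h i ** mixed = k *\<^sub>m (diag3 x y z ** mat3_of a b c d e f g h i)"
      by (rule scaled_similarE)
    from eq have "a = 0" "d = 0" "g = 0"
      by (auto simp: mat3_of_simps intro: row)
    with nz show False by simp
  qed
qed

text \<open>An intertwiner of diagonal matrices has a nonzero entry in position \<open>(i, j)\<close> only if the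
  corresponding eigenvalues agree, and one of the six terms of its determinant is nonzero.\<close>

lemma scaled_similar_diag_iff:
  "scaled_similar (diag3 x y z) (diag3 x' y' z') \<longleftrightarrow>
    (\<exists>k. k \<noteq> 0 \<and> ((x = k*x' \<and> y = k*y' \<and> z = k*z') \<or> (x = k*x' \<and> y = k*z' \<and> z = k*y')
      \<or> (x = k*y' \<and> y = k*x' \<and> z = k*z') \<or> (x = k*y' \<and> y = k*z' \<and> z = k*x')
      \<or> (x = k*z' \<and> y = k*x' \<and> z = k*y') \<or> (x = k*z' \<and> y = k*y' \<and> z = k*x')))"
  (is "?L \<longleftrightarrow> (\<exists>k. ?R k)")
proof
  assume ?L
  then obtain a b c d e f g h i k where k: "k \<noteq> 0"
    and "a*e*i + b*f*g + c*d*h - a*f*h - b*d*i - c*e*g \<noteq> 0"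
    and eq: "mat3_of a b c d e f g h i ** diag3 x y z =
      k *\<^sub>m (diag3 x' y' z' ** mat3_of a b c d e f g h i)"
    by (rule scaled_similarE)
  then consider "a*e*i \<noteq> 0" | "b*f*g \<noteq> 0" | "c*d*h \<noteq> 0" | "a*f*h \<noteq> 0" | "b*d*i \<noteq> 0" | "c*e*g \<noteq> 0"
    by fastforce
  then have "?R k" using k eq by cases (simp_all add: mat3_of_simps)
  then show "\<exists>k. ?R k" ..
next
  assume "\<exists>k. ?R k"
  then obtain k where "k \<noteq> 0" and "?R k" by blast
  then consider "x = k*x'" "y = k*y'" "z = k*z'"
    | "x = k*x'" "y = k*z'" "z = k*y'"
    | "x = k*y'" "y = k*x'" "z = k*z'"
    | "x = k*y'" "y = k*z'" "z = k*x'"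
    | "x = k*z'" "y = k*x'" "z = k*y'"
    | "x = k*z'" "y = k*y'" "z = k*x'" by blast
  then show ?L
  \<comment> \<open>Each intertwiner is a permutation matrix: its entry (i, j) is 1 where the j-th
    source eigenvalue is \<open>k\<close> times the i-th target eigenvalue.\<close>
  proof cases
    case 1
    then show ?thesis using \<open>k \<noteq> 0\<close>
      by (intro scaled_similarI[of "mat3_of 1 0 0 0 1 0 0 0 1" k]) (simp_all add: det_mat3_of mat3_of_simps)
  next
    case 2
    then show ?thesis using \<open>k \<noteq> 0\<close>
      by (intro scaled_similarI[of "mat3_of 1 0 0 0 0 1 0 1 0" k]) (simp_all add: det_mat3_of mat3_of_simps)
  next
    case 3
    then show ?thesis using \<open>k \<noteq> 0\<close>
      by (intro scaled_similarI[of "mat3_of 0 1 0 1 0 0 0 0 1" k]) (simp_all add: det_mat3_of mat3_of_simps)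
  next
    case 4
    then show ?thesis using \<open>k \<noteq> 0\<close>
      by (intro scaled_similarI[of "mat3_of 0 0 1 1 0 0 0 1 0" k]) (simp_all add: det_mat3_of mat3_of_simps)
  next
    case 5
    then show ?thesis using \<open>k \<noteq> 0\<close>
      by (intro scaled_similarI[of "mat3_of 0 1 0 0 0 1 1 0 0" k]) (simp_all add: det_mat3_of mat3_of_simps)
  next
    case 6
    then show ?thesis using \<open>k \<noteq> 0\<close>
      by (intro scaled_similarI[of "mat3_of 0 0 1 0 1 0 1 0 0" k]) (simp_all add: det_mat3_of mat3_of_simps)
  qed
qed

text \<open>Both diagonals have sum zero, so for each permutation one of the three proportionality
  equations follows from the other two. Eliminating \<open>k\<close> leaves one equation between
  \<alpha> and \<beta> per permutation.\<close>

lemma scaled_similar_J4_iff: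
  fixes \<alpha> \<beta> :: complex
  shows "scaled_similar (diag3 1 (\<alpha> - 1) (- \<alpha>)) (diag3 1 (\<beta> - 1) (- \<beta>)) \<longleftrightarrow>
    \<alpha> = 1 - \<beta> \<or> \<alpha> = \<beta> \<or> \<alpha> = (-1 + \<alpha>) * \<beta> \<or> \<alpha> = - (-1 + \<alpha>) * (-1 + \<beta>)
      \<or> \<alpha> * \<beta> = 1 \<or> - \<alpha> * (-1 + \<beta>) = 1"
  (is "?S \<longleftrightarrow> ?E")
proof
  assume ?S
  then obtain k where "k \<noteq> 0"
   and "(1 = k*1 \<and> \<alpha>-1 = k*(\<beta>-1) \<and> -\<alpha> = k*(-\<beta>)) \<or> (1 = k*1 \<and> \<alpha>-1 = k*(-\<beta>) \<and> -\<alpha> = k*(\<beta>-1))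
      \<or> (1 = k*(\<beta>-1) \<and> \<alpha>-1 = k*1 \<and> -\<alpha> = k*(-\<beta>)) \<or> (1 = k*(\<beta>-1) \<and> \<alpha>-1 = k*(-\<beta>) \<and> -\<alpha> = k*1)
      \<or> (1 = k*(-\<beta>) \<and> \<alpha>-1 = k*1 \<and> -\<alpha> = k*(\<beta>-1)) \<or> (1 = k*(-\<beta>) \<and> \<alpha>-1 = k*(\<beta>-1) \<and> -\<alpha> = k*1)"
    unfolding scaled_similar_diag_iff by blast
  then show ?E by (elim disjE conjE; algebra)
next
  assume ?E
  then consider "\<alpha> = 1 - \<beta>" | "\<alpha> = \<beta>" | "\<alpha> = (\<alpha> - 1) * \<beta>" | "(\<alpha> - 1) * \<beta> = - 1"
    | "\<alpha> * \<beta> = 1" | "\<alpha> * \<beta> = \<alpha> - 1"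
    by (auto simp: algebra_simps)
  then have "\<exists>k. k \<noteq> 0 \<and> ((1 = k*1 \<and> \<alpha>-1 = k*(\<beta>-1) \<and> -\<alpha> = k*(-\<beta>)) \<or> (1 = k*1 \<and> \<alpha>-1 = k*(-\<beta>) \<and> -\<alpha> = k*(\<beta>-1))
      \<or> (1 = k*(\<beta>-1) \<and> \<alpha>-1 = k*1 \<and> -\<alpha> = k*(-\<beta>)) \<or> (1 = k*(\<beta>-1) \<and> \<alpha>-1 = k*(-\<beta>) \<and> -\<alpha> = k*1)
      \<or> (1 = k*(-\<beta>) \<and> \<alpha>-1 = k*1 \<and> -\<alpha> = k*(\<beta>-1)) \<or> (1 = k*(-\<beta>) \<and> \<alpha>-1 = k*(\<beta>-1) \<and> -\<alpha> = k*1))"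
  \<comment> \<open>The scalar \<open>k\<close> is the entry of the \<alpha>-diagonal that is
    matched with the entry 1 of the \<beta>-diagonal.\<close>
  proof cases
    case 3
    then show ?thesis by (intro exI[of _ "\<alpha> - 1"]) (auto simp: algebra_simps)
  next
    case 4
    then show ?thesis by (intro exI[of _ "\<alpha> - 1"]) (auto simp: algebra_simps)
  next
    case 5
    then show ?thesis by (intro exI[of _ "- \<alpha>"]) (auto simp: algebra_simps)
  next
    case 6
    then show ?thesis by (intro exI[of _ "- \<alpha>"]) (auto simp: algebra_simps)
  qed (auto intro!: exI[of _ 1])
  then show ?S unfolding scaled_similar_diag_iff .
qed

text \<open>Each equation is solved for \<beta>. It cannot hold when the coefficient of \<beta>
  vanishes, so it already implies that the corresponding quotient is defined.\<close>

lemma J4_parameters_iff: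
  fixes \<alpha> \<beta> :: complex
  shows "(\<alpha> = 1 - \<beta> \<or> \<alpha> = \<beta> \<or> \<alpha> = (-1 + \<alpha>) * \<beta> \<or> \<alpha> = - (-1 + \<alpha>) * (-1 + \<beta>)
      \<or> \<alpha> * \<beta> = 1 \<or> - \<alpha> * (-1 + \<beta>) = 1) \<longleftrightarrow>
    (\<beta> = \<alpha> \<or> (\<alpha> \<noteq> 0 \<and> \<beta> = 1 / \<alpha>) \<or> \<beta> = 1 - \<alpha> \<or> (1 - \<alpha> \<noteq> 0 \<and> \<beta> = 1 / (1 - \<alpha>))
      \<or> (-1 + \<alpha> \<noteq> 0 \<and> \<beta> = \<alpha> / (-1 + \<alpha>)) \<or> (\<alpha> \<noteq> 0 \<and> \<beta> = (-1 + \<alpha>) / \<alpha>))"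
proof -
  have div: "y = x / z \<longleftrightarrow> y * z = x" if "z \<noteq> 0" for x y z :: complex
    using that by (simp add: nonzero_eq_divide_eq)
  have "\<alpha> = 1 - \<beta> \<longleftrightarrow> \<beta> = 1 - \<alpha>"
    by algebra
  moreover have "\<alpha> * \<beta> = 1 \<longleftrightarrow> \<alpha> \<noteq> 0 \<and> \<beta> * \<alpha> = 1"
    by (intro iffI conjI; algebra)
  moreover have "\<alpha> = - (-1 + \<alpha>) * (-1 + \<beta>) \<longleftrightarrow> 1 - \<alpha> \<noteq> 0 \<and> \<beta> * (1 - \<alpha>) = 1"
    by (intro iffI conjI; algebra)
  moreover have "\<alpha> = (-1 + \<alpha>) * \<beta> \<longleftrightarrow> -1 + \<alpha> \<noteq> 0 \<and> \<beta> * (-1 + \<alpha>) = \<alpha>"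
    by (intro iffI conjI; algebra)
  moreover have "- \<alpha> * (-1 + \<beta>) = 1 \<longleftrightarrow> \<alpha> \<noteq> 0 \<and> \<beta> * \<alpha> = -1 + \<alpha>"
    by (intro iffI conjI; algebra)
  ultimately show ?thesis by (metis div)
qed

section \<open>Triangularization\<close>

lemma eigenvectorE:
  fixes A :: mat3
  obtains x v where "v \<noteq> 0" "A *v v = x *s v"
proof -
  obtain a b c d e f g h i where A: "A = mat3_of a b c d e f g h i"
    by (rule mat3_of_cases)
  \<comment> \<open>The cubic is the characteristic polynomial: its coefficients are minus the
    trace, the sum of the principal 2x2 minors and minus the determinant.\<close>
  obtain x where x: "x ^ 3 + (- (a + e + i)) * x\<^sup>2
      + (a*e + a*i + e*i - b*d - c*g - f*h) * x - det A = 0"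
    using monic_cubic_root_exists[of "- (a + e + i)" "a*e + a*i + e*i - b*d - c*g - f*h" "- det A"]
    by auto
  have "A - mat x = mat3_of (a - x) b c d (e - x) f g h (i - x)"
    by (simp add: A mat3_of_def mat_def vec_eq_iff forall_3)
  then have "det (A - mat x) = (a-x)*(e-x)*(i-x) + b*f*g + c*d*h - (a-x)*f*h - b*d*(i-x) - c*(e-x)*g"
    by (simp only: det_mat3_of)
  then have "det (A - mat x) = 0"
    using x unfolding A det_mat3_of by algebra
  then have "\<not> (\<exists>B. B ** (A - mat x) = mat 1)"
    using invertible_det_nz[of "A - mat x"] invertible_left_inverse[of "A - mat x"] by blast
  then obtain v where "v \<noteq> 0" "(A - mat x) *v v = 0"
    unfolding matrix_left_invertible_ker by blast
  moreover have "mat x *v v = x *s v"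
    by (simp add: mat_def matrix_vector_mult_def vec_eq_iff if_distrib[of "\<lambda>z. z * _"] cong: if_cong)
  ultimately show thesis
    by (intro that) (simp_all add: matrix_vector_mult_diff_rdistrib)
qed

text \<open>In a basis beginning with an eigenvector, the first column of the matrix is a multiple
  of the first standard vector.\<close>

lemma scaled_similar_first_column:
  obtains a p q e f g h where "scaled_similar A (mat3_of a p q 0 e f 0 g h)"
proof -
  obtain x v where v: "v \<noteq> 0" "A *v v = x *s v" by (rule eigenvectorE)
  have "\<exists>Q. det Q \<noteq> 0 \<and> Q *v axis 1 1 = v"
  proof -
    have *: "mat3_of a b c d e f g h i *v axis 1 1 = v \<longleftrightarrow> a = v$1 \<and> d = v$2 \<and> g = v$3"
      for a b c d e f g h i
      by (auto simp: mat3_of_def matrix_vector_mult_def sum_3 vec_eq_iff forall_3 axis_def)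
    \<comment> \<open>\<open>v\<close> replaces a standard basis vector at a position where its
      coordinate is nonzero; the other two standard vectors complete the basis.\<close>
    from v(1) consider "v$1 \<noteq> 0" | "v$2 \<noteq> 0" | "v$3 \<noteq> 0"
      by (auto simp: vec_eq_iff forall_3)
    then show ?thesis
    proof cases
      case 1
      then show ?thesis
        by (intro exI[of _ "mat3_of (v$1) 0 0 (v$2) 1 0 (v$3) 0 1"]) (simp add: * det_mat3_of)
    next
      case 2
      then show ?thesis
        by (intro exI[of _ "mat3_of (v$1) 1 0 (v$2) 0 0 (v$3) 0 1"]) (simp add: * det_mat3_of)
    next
      case 3
      then show ?thesis
        by (intro exI[of _ "mat3_of (v$1) 1 0 (v$2) 0 1 (v$3) 0 0"]) (simp add: * det_mat3_of)
    qed
  qed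
  then obtain Q where Q: "det Q \<noteq> 0" "Q *v axis 1 1 = v" by blast
  define T where "T = matrix_inv Q ** A ** Q"
  have QT: "A ** Q = Q ** T"
    by (simp add: T_def matrix_mul_assoc matrix_inv_nonsingular[OF Q(1)])
  have "matrix_inv Q *v v = axis 1 1"
    by (simp add: Q(2)[symmetric] matrix_vector_mul_assoc matrix_inv_nonsingular[OF Q(1)])
  then have T1: "T *v axis 1 1 = x *s axis 1 1"
    by (simp add: T_def matrix_vector_mul_assoc[symmetric] Q(2) v(2) vector_scalar_commute)
  obtain a p q d e f g' g h where T: "T = mat3_of a p q d e f g' g h"
    by (rule mat3_of_cases)
  from T1 have "d = 0" "g' = 0"
    by (simp_all add: T mat3_of_def matrix_vector_mult_def sum_3 vec_eq_iff forall_3 axis_def)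
  with QT Q(1) T show thesis
    by (intro that scaled_similarI_columns) auto
qed

lemma scaled_similar_upper_triangular:
  obtains a p q b r c where "scaled_similar A (mat3_of a p q 0 b r 0 0 c)"
proof -
  obtain a p q e f g h where A: "scaled_similar A (mat3_of a p q 0 e f 0 g h)"
    by (rule scaled_similar_first_column)
  show thesis
  proof (cases "g = 0")
    case True
    with A that show thesis by blast
  next
    case False
    have "\<not> constant (poly [:- f, h - e, g:])"
      using False by (simp add: constant_degree)
    \<comment> \<open>The quadratic says that \<open>(w, 1)\<close> is an eigenvector of the lower
      right 2x2 block, with eigenvalue \<open>g * w + h\<close>. The new basis is
      \<open>(1, 0, 0)\<close>, \<open>(0, w, 1)\<close>, \<open>(0, 1, 0)\<close>.\<close>
    then obtain w where "poly [:- f, h - e, g:] w = 0"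
      using fundamental_theorem_of_algebra by blast
    then have "e * w + f = (g * w + h) * w"
      by (simp add: algebra_simps)
    then have "scaled_similar (mat3_of a p q 0 e f 0 g h)
        (mat3_of a (p * w + q) p 0 (g * w + h) g 0 0 (e - w * g))"
      by (intro scaled_similarI_columns[of "mat3_of 1 0 0 0 w 1 0 1 0"])
        (simp_all add: det_mat3_of mat3_of_simps algebra_simps)
    with A show thesis by (blast intro: that scaled_similar_trans)
  qed
qed

section \<open>Normal forms\<close>

lemma scaled_similar_trace:
  assumes "scaled_similar A B" "trace A = 0"
  shows "trace B = 0"
proof -
  obtain P k where P: "det P \<noteq> 0" "k \<noteq> 0" "P ** A = k *\<^sub>m (B ** P)"
    using assms(1) unfolding scaled_similar_def by blast
  have "k * trace B = trace (P ** A ** matrix_inv P)"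
    by (simp add: P(3) cscale_mult_left trace_cscale matrix_mul_assoc[symmetric]
        matrix_inv_nonsingular[OF P(1)])
  also have "\<dots> = trace (matrix_inv P ** (P ** A))" by (rule trace_mul_sym)
  also have "\<dots> = 0"
    by (simp add: matrix_mul_assoc matrix_inv_nonsingular[OF P(1)] assms(2))
  finally show ?thesis using P(2) by simp
qed

lemma scaled_similar_nonzero:
  assumes "scaled_similar A B" "A \<noteq> 0"
  shows "B \<noteq> 0"
proof
  assume "B = 0"
  obtain P k where P: "det P \<noteq> 0" "k \<noteq> 0" "P ** A = k *\<^sub>m (B ** P)"
    using assms(1) unfolding scaled_similar_def by blast
  from P(3) \<open>B = 0\<close> have "P ** A = 0"
    by (simp add: matrix_matrix_mult_def vec_eq_iff cscale_def)
  with P(1) assms(2) show False using nonsingular_mult_eq_0 by blast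
qed

text \<open>Each intertwiner consists of generalized eigenvectors of the triangular matrix.\<close>

lemma upper_triangular_similar_diag:
  assumes "a \<noteq> b" "a \<noteq> c" "b \<noteq> c"
  shows "scaled_similar (mat3_of a p q 0 b r 0 0 c) (diag3 a b c)"
proof -
  define x where "x = p / (b - a)"
  define y where "y = r / (c - b)"
  define z where "z = (p * y + q) / (c - a)"
  have "p = x * (b - a)" "r = y * (c - b)" "p * y + q = z * (c - a)"
    using assms by (simp_all add: x_def y_def z_def)
  then show ?thesis
    by (intro scaled_similarI_columns[of "mat3_of 1 x z 0 1 y 0 0 1"])
      (simp_all add: det_mat3_of mat3_of_simps algebra_simps)
qed

text \<open>Only the third basis vector changes: \<open>(x, y, 1)\<close> is an eigenvector for the
  simple eigenvalue \<open>c\<close>.\<close>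

lemma upper_triangular_similar_block:
  assumes "a \<noteq> c"
  shows "scaled_similar (mat3_of a p q 0 a r 0 0 c) (mat3_of a p 0 0 a 0 0 0 c)"
proof -
  define y where "y = r / (c - a)"
  define x where "x = (p * y + q) / (c - a)"
  have "r = y * (c - a)" "p * y + q = x * (c - a)"
    using assms by (simp_all add: x_def y_def)
  then show ?thesis
    by (intro scaled_similarI_columns[of "mat3_of 1 0 x 0 1 y 0 0 1"])
      (simp_all add: det_mat3_of mat3_of_simps algebra_simps)
qed

text \<open>The vectors \<open>(x, 1, 0)\<close> and \<open>(y, 0, 1)\<close> span the generalized
  eigenspace of \<open>b\<close>; the eigenvector for \<open>a\<close> is moved to the end.\<close>

lemma upper_triangular_similar_block_last:
  assumes "a \<noteq> b"
  shows "scaled_similar (mat3_of a p q 0 b r 0 0 b) (mat3_of b r 0 0 b 0 0 0 a)"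
proof -
  define x where "x = p / (b - a)"
  define y where "y = (q - r * x) / (b - a)"
  have "p = x * (b - a)" "q - r * x = y * (b - a)"
    using assms by (simp_all add: x_def y_def)
  then show ?thesis
    by (intro scaled_similarI_columns[of "mat3_of x y 1 1 0 0 0 1 0"])
      (simp_all add: det_mat3_of mat3_of_simps algebra_simps)
qed

text \<open>The generalized eigenspace of \<open>a\<close> is spanned by \<open>(1, 0, 0)\<close>
  and \<open>(0, y, 1)\<close>, and \<open>(x, 1, 0)\<close> is an eigenvector for \<open>b\<close>.
  The entry \<open>s\<close> may be zero or not, which is decided later.\<close>

lemma upper_triangular_similar_block_outer:
  assumes "a \<noteq> b"
  shows "\<exists>s. scaled_similar (mat3_of a p q 0 b r 0 0 a) (mat3_of a s 0 0 a 0 0 0 b)"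
proof -
  define x where "x = p / (b - a)"
  define y where "y = r / (a - b)"
  have "p = x * (b - a)" "r = y * (a - b)"
    using assms by (simp_all add: x_def y_def)
  then have "scaled_similar (mat3_of a p q 0 b r 0 0 a) (mat3_of a (p * y + q) 0 0 a 0 0 0 b)"
    by (intro scaled_similarI_columns[of "mat3_of 1 0 x 0 y 1 0 1 0"])
      (simp_all add: det_mat3_of mat3_of_simps algebra_simps)
  then show ?thesis ..
qed

text \<open>The square of the matrix has the single possibly nonzero entry \<open>p * r\<close>. If
  it is nonzero, the third standard vector generates a Jordan chain of length 3. Otherwise the
  columns are a nonzero image, a preimage of it and a further kernel vector.\<close>

lemma strictly_upper_triangular_cases:
  assumes "p \<noteq> 0 \<or> q \<noteq> 0 \<or> r \<noteq> 0"
  shows "scaled_similar (mat3_of 0 p q 0 0 r 0 0 0) nilp2 \<or>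
    scaled_similar (mat3_of 0 p q 0 0 r 0 0 0) nilp1"
proof -
  consider "p \<noteq> 0" "r \<noteq> 0" | "p \<noteq> 0" "r = 0" | "p = 0" "q \<noteq> 0" | "p = 0" "q = 0" "r \<noteq> 0"
    using assms by blast
  then show ?thesis
  proof cases
    case 1
    then show ?thesis
      by (intro disjI1 scaled_similarI_columns[of "mat3_of (p * r) q 0 0 r 0 0 0 1"])
        (simp_all add: det_mat3_of mat3_of_simps)
  next
    case 2
    then show ?thesis
      by (intro disjI2 scaled_similarI_columns[of "mat3_of p 0 0 0 1 (- q) 0 0 p"])
        (simp_all add: det_mat3_of mat3_of_simps)
  next
    case 3
    then show ?thesis
      by (intro disjI2 scaled_similarI_columns[of "mat3_of q 0 0 r 0 1 0 1 0"])
        (simp_all add: det_mat3_of mat3_of_simps)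
  next
    case 4
    then show ?thesis
      by (intro disjI2 scaled_similarI_columns[of "mat3_of 0 0 1 r 0 0 0 1 0"])
        (simp_all add: det_mat3_of mat3_of_simps)
  qed
qed

lemma traceless_diag_similar_J4:
  assumes "a + b + c = 0" "a \<noteq> 0 \<or> b \<noteq> 0"
  shows "\<exists>\<alpha>. scaled_similar (diag3 a b c) (diag3 1 (\<alpha> - 1) (- \<alpha>))"
proof (cases "a = 0")
  \<comment> \<open>The diagonal \<open>(0, b, - b)\<close> is a permutation of \<open>b\<close>
    times \<open>(1, - 1, 0)\<close>, which belongs to the parameter 0.\<close>
  case True
  with assms have "b \<noteq> 0" "c = - b" by (auto simp: add_eq_0_iff)
  with True show ?thesis
    unfolding scaled_similar_diag_iff by (intro exI[of _ 0] exI[of _ b]) simp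
next
  case False
  \<comment> \<open>Division by \<open>a\<close> makes the first entry 1; the third determines the
    parameter \<open>- c / a\<close>, and the trace takes care of the second.\<close>
  have "b = a * (- c / a - 1)" "c = a * - (- c / a)"
    using False assms(1) by (simp_all add: field_simps) algebra
  with False show ?thesis
    unfolding scaled_similar_diag_iff by (intro exI[of _ "- c / a"] exI[of _ a]) simp
qed

lemma traceless_block_cases:
  assumes "a \<noteq> c" "2 * a + c = 0"
  shows "scaled_similar (mat3_of a s 0 0 a 0 0 0 c) mixed \<or>
    (\<exists>\<alpha>. scaled_similar (mat3_of a s 0 0 a 0 0 0 c) (diag3 1 (\<alpha> - 1) (- \<alpha>)))"
proof -
  have c: "c = - 2 * a" using assms(2) by algebra
  with assms(1) have "a \<noteq> 0" by auto
  show ?thesis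
  proof (cases "s = 0")
    case True
    with \<open>a \<noteq> 0\<close> c show ?thesis using traceless_diag_similar_J4[of a a c] by simp
  next
    \<comment> \<open>Scaling by \<open>a\<close> normalizes the eigenvalues to 1, 1, -2;
      conjugation by a diagonal matrix then brings the off-diagonal entry \<open>s / a\<close> to
      1.\<close>
    case False
    with \<open>a \<noteq> 0\<close> c show ?thesis
      by (intro disjI1 scaled_similarI[of "diag3 (a / s) 1 1" a])
        (simp_all add: det_mat3_of mat3_of_simps)
  qed
qed

text \<open>After triangularization the cases are the coincidences on the diagonal: three distinct
  entries give a diagonal matrix, exactly two equal ones a block form, and three equal ones must be
  zero by the trace, which leaves the nilpotent types.\<close>

lemma traceless_normal_form:
  assumes "A \<noteq> 0" "trace A = 0"
  shows "scaled_similar A nilp2 \<or> scaled_similar A nilp1 \<or> scaled_similar A mixed \<or>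
    (\<exists>\<alpha>. scaled_similar A (diag3 1 (\<alpha> - 1) (- \<alpha>)))"
proof -
  define normal where "normal B \<longleftrightarrow> scaled_similar B nilp2 \<or> scaled_similar B nilp1 \<or>
    scaled_similar B mixed \<or> (\<exists>\<alpha>. scaled_similar B (diag3 1 (\<alpha> - 1) (- \<alpha>)))" for B
  have normal_trans: "normal B" if "scaled_similar B C" "normal C" for B C
    using that scaled_similar_trans[of B C] unfolding normal_def by blast
  obtain a p q b r c where T: "scaled_similar A (mat3_of a p q 0 b r 0 0 c)"
    by (rule scaled_similar_upper_triangular)
  have tr: "a + b + c = 0"
    using scaled_similar_trace[OF T assms(2)] by (simp add: trace_mat3_of)
  have nz: "mat3_of a p q 0 b r 0 0 c \<noteq> 0"
    using scaled_similar_nonzero[OF T assms(1)] .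
  have block: "normal (mat3_of x s 0 0 x 0 0 0 y)" if "x \<noteq> y" "2 * x + y = 0" for x y s
    using traceless_block_cases[OF that] unfolding normal_def by blast
  consider "a \<noteq> b" "a \<noteq> c" "b \<noteq> c" | "a = b" "b \<noteq> c" | "a \<noteq> b" "b = c" | "a \<noteq> b" "a = c"
    | "a = b" "b = c" by blast
  then have "normal (mat3_of a p q 0 b r 0 0 c)"
  proof cases
    case 1
    have "normal (diag3 a b c)"
      using traceless_diag_similar_J4[OF tr] 1(1) unfolding normal_def by auto
    with upper_triangular_similar_diag[OF 1] show ?thesis by (rule normal_trans)
  next
    case 2
    with block[of b c p] tr upper_triangular_similar_block[of b c p q r] show ?thesis
      by (auto intro: normal_trans)
  next
    case 3
    then have "normal (mat3_of b r 0 0 b 0 0 0 a)" using tr by (intro block) (auto simp: algebra_simps)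
    with upper_triangular_similar_block_last[OF 3(1), of p q r] show ?thesis
      unfolding 3(2)[symmetric] by (rule normal_trans)
  next
    case 4
    obtain s where "scaled_similar (mat3_of a p q 0 b r 0 0 a) (mat3_of a s 0 0 a 0 0 0 b)"
      using upper_triangular_similar_block_outer[OF 4(1)] by blast
    moreover have "normal (mat3_of a s 0 0 a 0 0 0 b)"
      using 4 tr by (intro block) (auto simp: algebra_simps)
    ultimately show ?thesis
      unfolding 4(2)[symmetric] by (rule normal_trans)
  next
    case 5
    with tr have "3 * a = 0" by simp
    with 5 have "a = 0" "b = 0" "c = 0" by simp_all
    moreover from this nz have "p \<noteq> 0 \<or> q \<noteq> 0 \<or> r \<noteq> 0"
      by (auto simp: zero_mat3_of mat3_of_eq_iff)
    ultimately show ?thesis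
      using strictly_upper_triangular_cases[of p q r] unfolding normal_def by auto
  qed
  with T have "normal A" by (rule normal_trans)
  then show ?thesis unfolding normal_def .
qed

theorem theorem6p1:
  shows
    "(\<forall>L. L \<in> {J1, J2, J3} \<union> range J4 \<longrightarrow> lie_subalgebra L \<and> mat.dim L = 1)
     \<and> (\<forall>L. lie_subalgebra L \<and> mat.dim L = 1 \<longrightarrow>
            solvable_algebra L \<and> (L \<sim> J1 \<or> L \<sim> J2 \<or> L \<sim> J3 \<or> (\<exists>\<alpha>. L \<sim> J4 \<alpha>)))
     \<and> \<not> J1 \<sim> J2 \<and> \<not> J1 \<sim> J3 \<and> \<not> J2 \<sim> J3
     \<and> (\<forall>\<alpha>. \<not> J1 \<sim> J4 \<alpha> \<and> \<not> J2 \<sim> J4 \<alpha> \<and> \<not> J3 \<sim> J4 \<alpha>)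
     \<and> (\<forall>\<alpha> \<beta>. J4 \<alpha> \<sim> J4 \<beta> \<longleftrightarrow>
            \<alpha> = 1 - \<beta> \<or> \<alpha> = \<beta> \<or> \<alpha> = (-1 + \<alpha>) * \<beta> \<or> \<alpha> = - (-1 + \<alpha>) * (-1 + \<beta>)
            \<or> \<alpha> * \<beta> = 1 \<or> - \<alpha> * (-1 + \<beta>) = 1)
     \<and> (\<forall>\<alpha> \<beta>. J4 \<alpha> \<sim> J4 \<beta> \<longleftrightarrow>
            \<beta> = \<alpha> \<or> (\<alpha> \<noteq> 0 \<and> \<beta> = 1 / \<alpha>) \<or> \<beta> = 1 - \<alpha> \<or> (1 - \<alpha> \<noteq> 0 \<and> \<beta> = 1 / (1 - \<alpha>))
            \<or> (-1 + \<alpha> \<noteq> 0 \<and> \<beta> = \<alpha> / (-1 + \<alpha>)) \<or> (\<alpha> \<noteq> 0 \<and> \<beta> = (-1 + \<alpha>) / \<alpha>))"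
proof (intro conjI)
  note nonzero = zero_mat3_of mat3_of_eq_iff
  note span_iff = J_span inner_equiv_span_iff nonzero
  show "\<forall>L. L \<in> {J1, J2, J3} \<union> range J4 \<longrightarrow> lie_subalgebra L \<and> mat.dim L = 1"
    by (auto simp: J_span nonzero trace_mat3_of
        intro!: lie_subalgebra_span_singleton dim_span_singleton[simplified])
  show "\<forall>L. lie_subalgebra L \<and> mat.dim L = 1 \<longrightarrow>
            solvable_algebra L \<and> (L \<sim> J1 \<or> L \<sim> J2 \<or> L \<sim> J3 \<or> (\<exists>\<alpha>. L \<sim> J4 \<alpha>))"
  proof (intro allI impI)
    fix L assume L: "lie_subalgebra L \<and> mat.dim L = 1"
    then obtain A where A: "A \<noteq> 0" "L = mat.span {A}"
      using dim_1_subspaceE unfolding lie_subalgebra_def by blast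
    then have "trace A = 0"
      using L mat.span_base[of A "{A}"] by (auto simp: lie_subalgebra_def A2_def)
    with A show "solvable_algebra L \<and> (L \<sim> J1 \<or> L \<sim> J2 \<or> L \<sim> J3 \<or> (\<exists>\<alpha>. L \<sim> J4 \<alpha>))"
      using traceless_normal_form[of A]
      by (simp add: solvable_algebra_span_singleton J_span inner_equiv_span_iff)
  qed
  show "\<not> J1 \<sim> J2" "\<not> J1 \<sim> J3" "\<not> J2 \<sim> J3"
    by (simp_all add: span_iff not_similar_nilp2_nilp1 not_similar_nilp2_mixed
        not_similar_nilp1_mixed)
  show "\<forall>\<alpha>. \<not> J1 \<sim> J4 \<alpha> \<and> \<not> J2 \<sim> J4 \<alpha> \<and> \<not> J3 \<sim> J4 \<alpha>"
    by (simp add: span_iff not_similar_diag)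
  have J4: "J4 \<alpha> \<sim> J4 \<beta> \<longleftrightarrow>
      scaled_similar (diag3 1 (\<alpha> - 1) (- \<alpha>)) (diag3 1 (\<beta> - 1) (- \<beta>))" for \<alpha> \<beta>
    by (simp add: span_iff)
  show "\<forall>\<alpha> \<beta>. J4 \<alpha> \<sim> J4 \<beta> \<longleftrightarrow>
            \<alpha> = 1 - \<beta> \<or> \<alpha> = \<beta> \<or> \<alpha> = (-1 + \<alpha>) * \<beta> \<or> \<alpha> = - (-1 + \<alpha>) * (-1 + \<beta>)
            \<or> \<alpha> * \<beta> = 1 \<or> - \<alpha> * (-1 + \<beta>) = 1"
    unfolding J4 by (intro allI scaled_similar_J4_iff)
  show "\<forall>\<alpha> \<beta>. J4 \<alpha> \<sim> J4 \<beta> \<longleftrightarrow>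
            \<beta> = \<alpha> \<or> (\<alpha> \<noteq> 0 \<and> \<beta> = 1 / \<alpha>) \<or> \<beta> = 1 - \<alpha> \<or> (1 - \<alpha> \<noteq> 0 \<and> \<beta> = 1 / (1 - \<alpha>))
            \<or> (-1 + \<alpha> \<noteq> 0 \<and> \<beta> = \<alpha> / (-1 + \<alpha>)) \<or> (\<alpha> \<noteq> 0 \<and> \<beta> = (-1 + \<alpha>) / \<alpha>)"
    unfolding J4 scaled_similar_J4_iff by (intro allI J4_parameters_iff)
qed

end
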